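(* For every square real matrix $X\in\mathbb{R}^{n\times n}$ there exist constants $c$ and $\mu>0$, independent of $\beta$, such that for every $\beta>0$ $$\big|\langle S^\beta_X,X\rangle-\langle S^\infty_X,X\rangle\big|\le \|S^\beta_X-S^\infty_X\|\,\|X\|,\qquad \|S^\beta_X-S^\infty_X\|\le \frac{c}{\mu}\,e^{-\mu\beta}.$$
   Context: $\Sigma_{n\times n}$ is the set of $n\times n$ doubly stochastic matrices: entrywise nonnegative matrices with all row sums and all column sums equal to $1$. $\langle S,X\rangle=\sum_{ij}S_{ij}X_{ij}$, and $\|\cdot\|$ is the Frobenius norm. Softassign: for a real $n\times n$ matrix $X$ and $\beta>0$, $S^\beta_X$ is the unique maximizer over $S\in\Sigma_{n\times n}$ of $\langle S,X\rangle+\frac1\beta\mathcal{H}(S)$, where $\mathcal{H}(S)=-\sum_{ij}S_{ij}\ln S_{ij}$ (with $0\ln 0=0$). $S^\infty_X=\lim_{\beta\to\infty}S^\beta_X$; this limit is known to exist and is a maximizer of $\langle S,X\rangle$ over $\Sigma_{n\times n}$. *)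

theory Defs
  imports "HOL-Analysis.Analysis"
begin

definition doubly_stochastic :: "(real ^ 'n ^ 'n) set" where
  "doubly_stochastic =
     {S. (\<forall>i j. 0 \<le> S $ i $ j) \<and> (\<forall>i. (\<Sum>j\<in>UNIV. S $ i $ j) = 1) \<and> (\<forall>j. (\<Sum>i\<in>UNIV. S $ i $ j) = 1)}"

(* The convention 0 ln 0 = 0 holds automatically, because of the factor 0. *)
definition matrix_entropy :: "real ^ 'n ^ 'n \<Rightarrow> real" where
  "matrix_entropy S = - (\<Sum>i\<in>UNIV. \<Sum>j\<in>UNIV. S $ i $ j * ln (S $ i $ j))"

definition softassign :: "real \<Rightarrow> real ^ 'n ^ 'n \<Rightarrow> real ^ 'n ^ 'n" where
  "softassign \<beta> X =
     (THE S. is_arg_max (\<lambda>S. S \<bullet> X + 1 / \<beta> * matrix_entropy S) (\<lambda>S. S \<in> doubly_stochastic) S)"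

definition softassign_limit :: "real ^ 'n ^ 'n \<Rightarrow> real ^ 'n ^ 'n" where
  "softassign_limit X = Lim at_top (\<lambda>\<beta>. softassign \<beta> X)"

(* The inner product and norm that the library puts on real ^ 'n ^ 'n are
   the Frobenius ones. *)
lemma inner_matrix_eq_sum:
  fixes S X :: "real ^ 'n ^ 'n"
  shows "S \<bullet> X = (\<Sum>i\<in>UNIV. \<Sum>j\<in>UNIV. S $ i $ j * X $ i $ j)"
  by (simp add: inner_vec_def)

lemma norm_matrix_eq_frobenius:
  fixes X :: "real ^ 'n ^ 'n"
  shows "norm X = sqrt (\<Sum>i\<in>UNIV. \<Sum>j\<in>UNIV. (X $ i $ j)\<^sup>2)"
  by (simp add: norm_eq_sqrt_inner inner_vec_def power2_eq_square)

end

theory Submission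
  imports Defs
begin

text \<open>
  Write the maximizer as S = (1 - l) Y + l Z with Y in the optimal face of the polytope of doubly
  stochastic matrices and Z in the hull of the remaining vertices, so that S loses at least
  l * \<open>\<Delta>\<close> in the linear objective. Comparing S with the entropy maximizer L of the
  optimal face, this loss is at most 1 / \<open>\<beta>\<close> times the entropy gain, which is at most
  O(l) - n l ln l. Dividing by l shows that l is exponentially small in \<open>\<beta>\<close>. The same
  comparison shows that the entropy of Y is within O(sqrt l) of that of L, and strong concavity of
  the entropy turns this into a bound on the norm of Y - L. In particular L is the limit.
\<close>

section \<open>Inequalities and continuity for \<open>-x ln x\<close>\<close>

definition entropy_term :: "real \<Rightarrow> real" where
  "entropy_term x = - (x * ln x)"

lemma matrix_entropy_eq_sum: "matrix_entropy S = (\<Sum>i\<in>UNIV. \<Sum>j\<in>UNIV. entropy_term (S $ i $ j))"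
  by (simp add: matrix_entropy_def entropy_term_def sum_negf)

lemma entropy_term_nonneg:
  assumes "0 \<le> x" "x \<le> 1"
  shows "0 \<le> entropy_term x"
proof (cases "x = 0")
  case False
  then have "ln x \<le> 0"
    using assms by simp
  then show ?thesis
    using assms(1) by (simp add: entropy_term_def mult_nonneg_nonpos)
qed (simp add: entropy_term_def)

text \<open>The tangent of this concave function at 1: multiply
  \<open>ln (1 / x) \<le> 1 / x - 1\<close> by x.\<close>

lemma entropy_term_le:
  assumes "0 \<le> x"
  shows "entropy_term x \<le> 1 - x"
proof (cases "x = 0")
  case False
  then have "x * (- ln x) \<le> x * (1 / x - 1)"
    using assms ln_le_minus_one[of "1 / x"] by (intro mult_left_mono) (auto simp: ln_div)
  then show ?thesis
    using False by (simp add: entropy_term_def algebra_simps)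
qed (simp add: entropy_term_def)

text \<open>Writing x as the square of \<open>sqrt x\<close> pulls out the factor
  \<open>2 * sqrt x\<close>; what remains is an entropy term, at most 1 by the tangent
  bound.\<close>

lemma entropy_term_le_sqrt:
  assumes "0 \<le> x"
  shows "entropy_term x \<le> 2 * sqrt x"
proof (cases "x = 0")
  case False
  have "entropy_term x = 2 * sqrt x * entropy_term (sqrt x)"
    using assms False by (simp add: entropy_term_def ln_sqrt)
  also have "\<dots> \<le> 2 * sqrt x * 1"
    using entropy_term_le[of "sqrt x"] assms
    by (intro mult_left_mono) (auto intro: order_trans)
  finally show ?thesis by simp
qed (simp add: entropy_term_def)

text \<open>Since ln is increasing, enlarging its argument from x or y to x + y can only raise
  \<open>x * ln x\<close> and \<open>y * ln y\<close>.\<close>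

lemma entropy_term_add_le:
  assumes "0 \<le> x" "0 \<le> y"
  shows "entropy_term (x + y) \<le> entropy_term x + entropy_term y"
proof -
  have *: "a * ln a \<le> a * ln (a + b)" if "0 \<le> a" "0 \<le> b" for a b :: real
    using that by (cases "a = 0") (auto intro!: mult_left_mono)
  show ?thesis
    using *[OF assms] *[OF assms(2,1)]
    by (simp add: entropy_term_def algebra_simps)
qed

lemma entropy_term_mult:
  assumes "0 \<le> x" "0 \<le> y"
  shows "entropy_term (x * y) = x * entropy_term y + y * entropy_term x"
  using assms by (cases "x = 0 \<or> y = 0") (auto simp: entropy_term_def ln_mult algebra_simps)

text \<open>On (0, 1] the second derivative of \<open>x * ln x\<close> is 1/x, hence at least 1, so
  subtracting \<open>x\<^sup>2 / 2\<close> leaves a convex function. The midpoint defect of that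
  square is \<open>(x - y)\<^sup>2 / 8\<close>. The endpoint 0, where ln is singular, is treated by
  hand.\<close>

lemma entropy_term_midpoint:
  assumes "x \<in> {0..1}" "y \<in> {0..1}"
  shows "(entropy_term x + entropy_term y) / 2 + (x - y)\<^sup>2 / 8 \<le> entropy_term ((x + y) / 2)"
proof -
  have ln2: "ln 2 \<ge> (1 / 4 :: real)"
    using ln_le_minus_one[of "1 / 2 :: real"] by (simp add: ln_div)
  \<comment> \<open>Halving a adds exactly \<open>a * ln 2 / 2\<close> to half of its entropy term,
    so ln 2 \<ge> 1/4 suffices.\<close>
  have zero: "entropy_term a / 2 + a\<^sup>2 / 8 \<le> entropy_term (a / 2)"
    if "a \<in> {0..1}" for a :: real
  proof (cases "a = 0")
    case False
    have "a\<^sup>2 / 8 \<le> a / 8"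
      using that by (simp add: power2_eq_square mult_left_le)
    also have "\<dots> \<le> a * ln 2 / 2"
      using ln2 that mult_left_mono[OF ln2, of a] by simp
    finally show ?thesis
      using False that by (simp add: entropy_term_def ln_div algebra_simps)
  qed (simp add: entropy_term_def)
  have "convex_on {0<..1} (\<lambda>x::real. x * ln x - x\<^sup>2 / 2)"
  proof (rule f''_ge0_imp_convex)
    show "((\<lambda>x. x * ln x - x\<^sup>2 / 2) has_real_derivative ln x + 1 - x) (at x)"
      if "x \<in> {0<..1}" for x :: real
      using that by (auto intro!: derivative_eq_intros)
    show "((\<lambda>x. ln x + 1 - x) has_real_derivative 1 / x - 1) (at x)"
      if "x \<in> {0<..1}" for x :: real
      using that by (auto intro!: derivative_eq_intros)
  qed (auto simp: field_simps)
  from convex_onD[OF this, of "1/2" x y]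
  have pos: ?thesis if "0 < x" "0 < y"
    using that assms by (simp add: entropy_term_def power2_eq_square field_simps)
  consider "x = 0" | "y = 0" | "0 < x" "0 < y"
    using assms by fastforce
  then show ?thesis
    by cases (use zero[OF assms(1)] zero[OF assms(2)] pos in \<open>auto simp: entropy_term_def\<close>)
qed

text \<open>Only 0 is delicate; there the function is squeezed between 0 and
  \<open>2 * sqrt x\<close>.\<close>

lemma continuous_on_entropy_term: "continuous_on {0..} entropy_term"
  unfolding continuous_on_def
proof (intro ballI)
  fix x :: real
  assume x: "x \<in> {0..}"
  show "(entropy_term \<longlongrightarrow> entropy_term x) (at x within {0..})"
  proof (cases "x = 0")
    case True
    have "((\<lambda>x. 2 * sqrt x) \<longlongrightarrow> 2 * sqrt 0) (at 0 within {0..})"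
      by (intro tendsto_intros)
    moreover have "\<forall>\<^sub>F x in at 0 within {0..1}. norm (entropy_term x) \<le> 2 * sqrt x"
      by (auto simp: eventually_at_filter entropy_term_nonneg entropy_term_le_sqrt)
    \<comment> \<open>Nonnegativity holds on [0, 1] only, and near 0 this interval gives the same
      filter as the half-line.\<close>
    moreover have "at (0::real) within {0..} = at 0 within {0..1}"
      by (rule at_within_nhd[of _ "{..<1}"]) auto
    ultimately have "(entropy_term \<longlongrightarrow> 0) (at 0 within {0..})"
      by (auto intro: Lim_null_comparison)
    then show ?thesis
      using True by (simp add: entropy_term_def)
  next
    case False
    then show ?thesis
      using x unfolding entropy_term_def by (intro tendsto_intros) auto
  qed
qed

lemma continuous_on_matrix_entropy: "continuous_on doubly_stochastic matrix_entropy"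
proof -
  have "continuous_on doubly_stochastic (\<lambda>S::real^'a^'a. entropy_term (S $ i $ j))" for i j
    by (rule continuous_on_compose2[OF continuous_on_entropy_term])
       (auto intro!: continuous_intros simp: doubly_stochastic_def)
  then show ?thesis
    unfolding matrix_entropy_eq_sum by (intro continuous_intros)
qed

section \<open>The polytope of doubly stochastic matrices and its optimal face\<close>

lemma doubly_stochastic_mem_Icc:
  assumes "S \<in> doubly_stochastic"
  shows "S $ i $ j \<in> {0..1}"
proof -
  have "S $ i $ j \<le> (\<Sum>j\<in>UNIV. S $ i $ j)"
    using assms by (intro member_le_sum) (auto simp: doubly_stochastic_def)
  then show ?thesis
    using assms by (simp add: doubly_stochastic_def)
qed

lemma doubly_stochastic_nonempty: "doubly_stochastic \<noteq> {}"
proof -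
  have "mat 1 \<in> (doubly_stochastic :: (real^'a^'a) set)"
    by (simp add: doubly_stochastic_def mat_def)
  then show ?thesis by blast
qed

text \<open>Having finitely many vertices is what yields a positive gap between optimal and other
  vertices. The set is cut out by finitely many half-spaces and hyperplanes and is bounded because
  entries lie in [0, 1].\<close>

lemma polytope_doubly_stochastic: "polytope (doubly_stochastic :: (real^'n^'n) set)"
  unfolding polytope_eq_bounded_polyhedron
proof
  \<comment> \<open>The normals are the matrices with ones in column j and, below, with ones in row
    i.\<close>
  have "(\<chi> i. axis j 1) \<bullet> S = (\<Sum>i\<in>UNIV. S $ i $ j)" for S :: "real^'n^'n" and j
    by (simp add: inner_vec_def[of _ S] inner_axis')
  moreover have "axis i (\<chi> j. 1) \<bullet> S = (\<Sum>j\<in>UNIV. S $ i $ j)" for S :: "real^'n^'n" and i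
    unfolding inner_axis' by (simp add: inner_vec_def)
  ultimately have "(doubly_stochastic :: (real^'n^'n) set) =
    (\<Inter>i. \<Inter>j. {S. axis i (axis j 1) \<bullet> S \<ge> 0}) \<inter> (\<Inter>i. {S. axis i (\<chi> j. 1) \<bullet> S = 1}) \<inter>
    (\<Inter>j. {S. (\<chi> i. axis j 1) \<bullet> S = 1})"
    by (auto simp: doubly_stochastic_def inner_axis')
  also have "polyhedron \<dots>"
    by (intro polyhedron_Int polyhedron_Inter finite_imageI finite)
       (auto intro!: polyhedron_Inter polyhedron_halfspace_ge polyhedron_hyperplane)
  finally show "polyhedron (doubly_stochastic :: (real^'n^'n) set)" .
next
  have "(doubly_stochastic :: (real^'n^'n) set) \<subseteq> {0..\<chi> i j. 1}"
    using doubly_stochastic_mem_Icc by (fastforce simp: less_eq_vec_def)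
  then show "bounded (doubly_stochastic :: (real^'n^'n) set)"
    by (rule bounded_subset[OF bounded_closed_interval])
qed

text \<open>F is the convex hull of the optimal vertices; \<open>\<Delta>\<close> is the gap to the best other vertex.\<close>

lemma polytope_optimal_face_decomposition:
  fixes P :: "'a::euclidean_space set"
  assumes "polytope P" "P \<noteq> {}"
  obtains F M \<Delta> where "F \<subseteq> P" "F \<noteq> {}" "convex F" "compact F" "\<Delta> > 0"
    "\<And>y. y \<in> F \<Longrightarrow> y \<bullet> x = M"
    "\<And>s. s \<in> P \<Longrightarrow> \<exists>y\<in>F. \<exists>z\<in>P. \<exists>l\<in>{0..1}. s = (1 - l) *\<^sub>R y + l *\<^sub>R z \<and> s \<bullet> x \<le> M - l * \<Delta>"
proof -
  obtain V where V: "finite V" "P = convex hull V"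
    using assms(1) unfolding polytope_def by blast
  have "V \<noteq> {}"
    using V assms(2) by auto
  define M where "M = Max ((\<lambda>v. v \<bullet> x) ` V)"
  define V1 where "V1 = {v \<in> V. v \<bullet> x = M}"
  define V2 where "V2 = {v \<in> V. v \<bullet> x < M}"
  have VM: "v \<bullet> x \<le> M" if "v \<in> V" for v
    unfolding M_def using V that by simp
  then have Vun: "V = V1 \<union> V2"
    by (force simp: V1_def V2_def)
  have "M \<in> (\<lambda>v. v \<bullet> x) ` V"
    unfolding M_def using V \<open>V \<noteq> {}\<close> by (intro Max_in) auto
  then have ne: "V1 \<noteq> {}"
    by (auto simp: V1_def)
  have "convex hull V1 \<subseteq> {y. x \<bullet> y = M}"
    using convex_hyperplane by (rule hull_minimal[rotated]) (auto simp: V1_def inner_commute)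
  then have face: "y \<bullet> x = M" if "y \<in> convex hull V1" for y
    using that by (auto simp: inner_commute)
  obtain \<Delta> where \<Delta>: "\<Delta> > 0" "\<And>v. v \<in> V2 \<Longrightarrow> v \<bullet> x \<le> M - \<Delta>"
  proof (cases "V2 = {}")
    case True
    \<comment> \<open>All vertices are optimal and the gap condition is vacuous; 1 is an arbitrary
      positive value.\<close>
    then show ?thesis using that[of 1] by simp
  next
    case False
    have fin: "finite ((\<lambda>v. v \<bullet> x) ` V2)"
      using V by (simp add: V2_def)
    then have "Max ((\<lambda>v. v \<bullet> x) ` V2) \<in> (\<lambda>v. v \<bullet> x) ` V2"
      using False by (intro Max_in) auto
    then have "Max ((\<lambda>v. v \<bullet> x) ` V2) < M"
      by (auto simp: V2_def)
    then show ?thesis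
      using that[of "M - Max ((\<lambda>v. v \<bullet> x) ` V2)"] fin by simp
  qed
  have "convex hull V2 \<subseteq> {y. x \<bullet> y \<le> M - \<Delta>}"
    using convex_halfspace_le by (rule hull_minimal[rotated]) (use \<Delta>(2) in \<open>auto simp: inner_commute\<close>)
  then have nonopt: "z \<bullet> x \<le> M - \<Delta>" if "z \<in> convex hull V2" for z
    using that by (auto simp: inner_commute)
  have sub: "convex hull V1 \<subseteq> P" "convex hull V2 \<subseteq> P"
    using Vun unfolding V(2) by (auto intro!: hull_mono)
  have dec: "\<exists>y\<in>convex hull V1. \<exists>z\<in>P. \<exists>l\<in>{0..1}. s = (1 - l) *\<^sub>R y + l *\<^sub>R z \<and> s \<bullet> x \<le> M - l * \<Delta>"
    if s: "s \<in> P" for s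
  proof (cases "V2 = {}")
    case True
    then have "s \<in> convex hull V1"
      using s V Vun by simp
    \<comment> \<open>With weight 0, the point s serves as both y and z.\<close>
    then show ?thesis
      using s face by (intro bexI[of _ s] bexI[of _ 0]) auto
  next
    case False
    have "s \<in> convex hull (V1 \<union> V2)"
      using s V(2) Vun by simp
    \<comment> \<open>The hull of a union of two nonempty convex sets consists of the segments
      joining them, so the vertex sets are first replaced by their hulls.\<close>
    moreover have "V1 \<union> V2 \<subseteq> convex hull V1 \<union> convex hull V2"
      by (intro Un_mono hull_subset)
    ultimately have "s \<in> convex hull (convex hull V1 \<union> convex hull V2)"
      using hull_mono by blast
    also have "\<dots> = {u *\<^sub>R y + l *\<^sub>R z | u l y z.
        u \<ge> 0 \<and> l \<ge> 0 \<and> u + l = 1 \<and> y \<in> convex hull V1 \<and> z \<in> convex hull V2}"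
      using ne False by (intro convex_hull_union_two) auto
    finally obtain u l y z where ul: "0 \<le> u" "0 \<le> l" "u + l = 1"
      and yz: "y \<in> convex hull V1" "z \<in> convex hull V2" and s_eq: "s = u *\<^sub>R y + l *\<^sub>R z"
      by blast
    have "u = 1 - l"
      using ul(3) by simp
    with ul yz s_eq have *: "0 \<le> l" "l \<le> 1" "y \<in> convex hull V1" "z \<in> convex hull V2"
      "s = (1 - l) *\<^sub>R y + l *\<^sub>R z"
      by simp_all
    have "s \<bullet> x = (1 - l) * M + l * (z \<bullet> x)"
      using * face by (simp add: inner_add_left)
    also have "\<dots> \<le> (1 - l) * M + l * (M - \<Delta>)"
      using * nonopt by (intro add_left_mono mult_left_mono) auto
    finally have "s \<bullet> x \<le> M - l * \<Delta>"
      by (simp add: algebra_simps)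
    then show ?thesis
      using * sub by (intro bexI[of _ y] bexI[of _ z] bexI[of _ l]) auto
  qed
  show ?thesis
  proof (rule that[of "convex hull V1" \<Delta> M])
    show "compact (convex hull V1)"
      using V by (simp add: V1_def finite_imp_compact_convex_hull)
  qed (use sub ne face dec \<Delta> in auto)
qed

section \<open>Entropy of doubly stochastic matrices\<close>

lemma convex_doubly_stochastic: "convex doubly_stochastic"
  using polytope_doubly_stochastic by (rule polytope_imp_convex)

lemma compact_doubly_stochastic: "compact doubly_stochastic"
  using polytope_doubly_stochastic by (rule polytope_imp_compact)

lemma matrix_entropy_nonneg:
  assumes "S \<in> doubly_stochastic"
  shows "0 \<le> matrix_entropy S"
  unfolding matrix_entropy_eq_sum using doubly_stochastic_mem_Icc[OF assms]
  by (intro sum_nonneg entropy_term_nonneg) auto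

lemma matrix_entropy_le:
  fixes S :: "real^'n^'n"
  assumes "S \<in> doubly_stochastic"
  shows "matrix_entropy S \<le> (real CARD('n))\<^sup>2"
proof -
  have "entropy_term (S $ i $ j) \<le> 1" for i j
    using entropy_term_le[of "S $ i $ j"] doubly_stochastic_mem_Icc[OF assms, of i j] by auto
  then have "matrix_entropy S \<le> (\<Sum>i\<in>(UNIV::'n set). \<Sum>j\<in>(UNIV::'n set). 1)"
    unfolding matrix_entropy_eq_sum by (intro sum_mono) auto
  then show ?thesis
    by (simp add: power2_eq_square)
qed

text \<open>The scalar midpoint inequality is summed over the entries; the squared differences add
  up to the squared Frobenius norm.\<close>

lemma matrix_entropy_midpoint:
  fixes S T :: "real^'n^'n"
  assumes "S \<in> doubly_stochastic" "T \<in> doubly_stochastic"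
  shows "(matrix_entropy S + matrix_entropy T) / 2 + (norm (S - T))\<^sup>2 / 8
    \<le> matrix_entropy ((1 / 2) *\<^sub>R (S + T))"
proof -
  have "(matrix_entropy S + matrix_entropy T) / 2 + (norm (S - T))\<^sup>2 / 8 =
    (\<Sum>i\<in>UNIV. \<Sum>j\<in>UNIV. (entropy_term (S $ i $ j) + entropy_term (T $ i $ j)) / 2
      + (S $ i $ j - T $ i $ j)\<^sup>2 / 8)"
    by (simp add: matrix_entropy_eq_sum norm_matrix_eq_frobenius sum_nonneg sum.distrib
        flip: sum_divide_distrib)
  also have "\<dots> \<le> matrix_entropy ((1 / 2) *\<^sub>R (S + T))"
    unfolding matrix_entropy_eq_sum
    using entropy_term_midpoint[OF doubly_stochastic_mem_Icc[OF assms(1)] doubly_stochastic_mem_Icc[OF assms(2)]]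
    by (intro sum_mono) simp
  finally show ?thesis .
qed

text \<open>Mixing gains at most the entropy of the weights, times the total mass n of a doubly
  stochastic matrix. Entrywise, subadditivity separates the two summands and the product rule
  separates weight from entry.\<close>

lemma matrix_entropy_convex_combination_le:
  fixes S T :: "real^'n^'n"
  assumes S: "S \<in> doubly_stochastic" and T: "T \<in> doubly_stochastic" and l: "l \<in> {0..1}"
  shows "matrix_entropy ((1 - l) *\<^sub>R S + l *\<^sub>R T) \<le>
    (1 - l) * matrix_entropy S + l * matrix_entropy T
      + real CARD('n) * (entropy_term (1 - l) + entropy_term l)"
proof -
  have total: "(\<Sum>i\<in>UNIV. \<Sum>j\<in>UNIV. R $ i $ j) = real CARD('n)"
    if "R \<in> doubly_stochastic" for R :: "real^'n^'n"
    using that by (simp add: doubly_stochastic_def)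
  have "entropy_term ((1 - l) * S $ i $ j + l * T $ i $ j) \<le>
      (1 - l) * entropy_term (S $ i $ j) + l * entropy_term (T $ i $ j)
       + (S $ i $ j * entropy_term (1 - l) + T $ i $ j * entropy_term l)" for i j
    using entropy_term_add_le[of "(1 - l) * S $ i $ j" "l * T $ i $ j"] l
      doubly_stochastic_mem_Icc[OF S, of i j] doubly_stochastic_mem_Icc[OF T, of i j]
    by (simp add: entropy_term_mult)
  then have "matrix_entropy ((1 - l) *\<^sub>R S + l *\<^sub>R T) \<le> (\<Sum>i\<in>UNIV. \<Sum>j\<in>UNIV.
      (1 - l) * entropy_term (S $ i $ j) + l * entropy_term (T $ i $ j)
       + (S $ i $ j * entropy_term (1 - l) + T $ i $ j * entropy_term l))"
    unfolding matrix_entropy_eq_sum by (intro sum_mono) simp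
  also have "\<dots> = (1 - l) * matrix_entropy S + l * matrix_entropy T
      + real CARD('n) * (entropy_term (1 - l) + entropy_term l)"
    using total[OF S] total[OF T]
    by (simp add: matrix_entropy_eq_sum sum.distrib distrib_left
        flip: sum_distrib_left sum_distrib_right)
  finally show ?thesis .
qed

section \<open>Maximizers of the entropy-regularized objective\<close>

text \<open>Quadratic growth: the midpoint of Y and S cannot beat S, yet strong concavity lifts it
  by \<open>b * (norm (Y - S))\<^sup>2 / 8\<close> above the average of the two values.\<close>

lemma is_arg_max_norm_diff_le:
  fixes X S Y :: "real^'n^'n"
  assumes F: "F \<subseteq> doubly_stochastic" "convex F" and b: "0 \<le> b"
    and S: "is_arg_max (\<lambda>S. S \<bullet> X + b * matrix_entropy S) (\<lambda>S. S \<in> F) S" and Y: "Y \<in> F"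
  shows "b * (norm (Y - S))\<^sup>2
    \<le> 4 * ((S \<bullet> X + b * matrix_entropy S) - (Y \<bullet> X + b * matrix_entropy Y))"
proof -
  define Z where "Z = (1 / 2) *\<^sub>R (Y + S)"
  have "S \<in> F"
    using S by (simp add: is_arg_max_linorder)
  then have "Z \<in> F"
    unfolding Z_def using convexD[OF F(2) Y, of S "1/2" "1/2"] by (simp add: scaleR_add_right)
  then have "Z \<bullet> X + b * matrix_entropy Z \<le> S \<bullet> X + b * matrix_entropy S"
    using S by (simp add: is_arg_max_linorder)
  moreover have "b * ((matrix_entropy Y + matrix_entropy S) / 2 + (norm (Y - S))\<^sup>2 / 8)
    \<le> b * matrix_entropy Z"
    unfolding Z_def using matrix_entropy_midpoint[of Y S] F(1) Y \<open>S \<in> F\<close> b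
    by (intro mult_left_mono) auto
  moreover have "Z \<bullet> X = (Y \<bullet> X + S \<bullet> X) / 2"
    by (simp add: Z_def inner_add_left)
  ultimately show ?thesis
    by (simp add: field_simps)
qed

lemma is_arg_max_exists:
  fixes X :: "real^'n^'n"
  assumes "F \<subseteq> doubly_stochastic" "compact F" "F \<noteq> {}"
  shows "\<exists>S. is_arg_max (\<lambda>S. S \<bullet> X + b * matrix_entropy S) (\<lambda>S. S \<in> F) S"
proof -
  have "continuous_on F (\<lambda>S. S \<bullet> X + b * matrix_entropy S)"
    using continuous_on_subset[OF continuous_on_matrix_entropy assms(1)]
    by (intro continuous_intros)
  from continuous_attains_sup[OF assms(2,3) this] show ?thesis
    by (auto simp: is_arg_max_linorder)
qed

text \<open>Justifies the definite description: compactness gives existence, and quadratic growth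
  forces two maximizers, having equal values, to coincide.\<close>

lemma softassign_is_arg_max:
  assumes "\<beta> > 0"
  shows "is_arg_max (\<lambda>S. S \<bullet> X + 1 / \<beta> * matrix_entropy S) (\<lambda>S. S \<in> doubly_stochastic)
    (softassign \<beta> X)"
proof -
  let ?m = "is_arg_max (\<lambda>S. S \<bullet> X + 1 / \<beta> * matrix_entropy S) (\<lambda>S. S \<in> doubly_stochastic)"
  obtain S where S: "?m S"
    using is_arg_max_exists[OF order.refl compact_doubly_stochastic doubly_stochastic_nonempty]
    by blast
  have "T = S" if T: "?m T" for T
  proof -
    have "1 / \<beta> * (norm (T - S))\<^sup>2 \<le> 0"
      using is_arg_max_norm_diff_le[OF order.refl convex_doubly_stochastic _ S, of T] assms S T
      by (fastforce simp: is_arg_max_linorder)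
    then show ?thesis
      using assms by (simp add: divide_le_0_iff)
  qed
  with S show ?thesis
    unfolding softassign_def by (rule theI)
qed

section \<open>Exponential convergence\<close>

text \<open>Stated for some L so that convergence is not presupposed; the bound itself later
  identifies L with \<open>softassign_limit X\<close>. The rate obtained is
  \<open>\<Delta> / (4 * n)\<close>.\<close>

lemma softassign_exponential_bound:
  fixes X :: "real^'n^'n"
  obtains L c \<mu> where "\<mu> > 0"
    "\<And>\<beta>. \<beta> > 0 \<Longrightarrow> norm (softassign \<beta> X - L) \<le> c * exp (- \<mu> * \<beta>)"
proof -
  define n where "n = real CARD('n)"
  have n: "n > 0"
    by (simp add: n_def)
  obtain F M \<Delta> where F: "F \<subseteq> doubly_stochastic" "F \<noteq> {}" "convex F" "compact F" and "\<Delta> > 0"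
    and face: "\<And>Y. Y \<in> F \<Longrightarrow> Y \<bullet> X = M"
    and dec: "\<And>S. S \<in> doubly_stochastic \<Longrightarrow> \<exists>Y\<in>F. \<exists>Z\<in>doubly_stochastic. \<exists>l\<in>{0..1}.
      S = (1 - l) *\<^sub>R Y + l *\<^sub>R Z \<and> S \<bullet> X \<le> M - l * \<Delta>"
    using polytope_optimal_face_decomposition[OF polytope_doubly_stochastic doubly_stochastic_nonempty]
    by metis
  \<comment> \<open>The zero matrix and weight 1 cast pure entropy maximization over F in the form
    of the regularized problem.\<close>
  obtain L where L: "is_arg_max (\<lambda>S. S \<bullet> 0 + 1 * matrix_entropy S) (\<lambda>S. S \<in> F) L"
    using is_arg_max_exists[OF F(1,4,2)] by blast
  then have LF: "L \<in> F" and Lmax: "\<And>Y. Y \<in> F \<Longrightarrow> matrix_entropy Y \<le> matrix_entropy L"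
    by (auto simp: is_arg_max_linorder)
  obtain D where D: "\<And>S::real^'n^'n. S \<in> doubly_stochastic \<Longrightarrow> norm S \<le> D"
    using compact_imp_bounded[OF compact_doubly_stochastic] unfolding bounded_iff by blast
  define A where "A = 4 * (n\<^sup>2 + 3 * n)"
  have "A \<ge> 0"
    using n by (simp add: A_def)
  \<comment> \<open>C and \<delta> arise from dividing
    \<open>n * ln l \<le> n\<^sup>2 + n - \<beta> * \<Delta>\<close> by n.\<close>
  define C where "C = (n\<^sup>2 + n) / n"
  define \<delta> where "\<delta> = \<Delta> / n"
  have bound: "norm (softassign \<beta> X - L) \<le> (2 * D + sqrt A) * exp (C / 4) * exp (- (\<delta> / 4) * \<beta>)"
    if \<beta>: "\<beta> > 0" for \<beta>
  proof -
    define S where "S = softassign \<beta> X"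
    have S: "S \<in> doubly_stochastic"
      and Smax: "\<And>T. T \<in> doubly_stochastic \<Longrightarrow>
        T \<bullet> X + 1 / \<beta> * matrix_entropy T \<le> S \<bullet> X + 1 / \<beta> * matrix_entropy S"
      using softassign_is_arg_max[OF \<beta>, of X] by (auto simp: is_arg_max_linorder S_def)
    obtain Y Z l where Y: "Y \<in> F" and Z: "Z \<in> doubly_stochastic" and l: "l \<in> {0..1}"
      and Seq: "S = (1 - l) *\<^sub>R Y + l *\<^sub>R Z" and SX: "S \<bullet> X \<le> M - l * \<Delta>"
      using dec[OF S] by blast
    have Y': "Y \<in> doubly_stochastic"
      using Y F by blast
    \<comment> \<open>Test the maximality of S against L, whose linear value is M.\<close>
    have gap: "\<beta> * (l * \<Delta>) \<le> matrix_entropy S - matrix_entropy L"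
    proof -
      have "l * \<Delta> \<le> 1 / \<beta> * (matrix_entropy S - matrix_entropy L)"
        using Smax[of L] F(1) LF face[OF LF] SX by (auto simp: algebra_simps diff_divide_distrib)
      then show ?thesis
        using \<beta> by (simp add: field_simps)
    qed
    \<comment> \<open>Everything but the entropy term of l is linear in l; that term alone yields
      the logarithm below.\<close>
    have HS: "matrix_entropy S \<le> matrix_entropy Y + l * (n\<^sup>2 + n) + n * entropy_term l"
    proof -
      have "l * (matrix_entropy Z - matrix_entropy Y) \<le> l * n\<^sup>2"
        using matrix_entropy_le[OF Z] matrix_entropy_nonneg[OF Y'] l
        by (intro mult_left_mono) (auto simp: n_def)
      moreover have "n * entropy_term (1 - l) \<le> l * n"
        using entropy_term_le[of "1 - l"] l n unfolding mult.commute[of l]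
        by (intro mult_left_mono) auto
      ultimately show ?thesis
        using matrix_entropy_convex_combination_le[OF Y' Z l, folded n_def Seq]
        unfolding ring_distribs by linarith
    qed
    \<comment> \<open>As Y has at most the entropy of L, both entropies cancel; dividing by l > 0
      leaves an upper bound for ln l.\<close>
    have l_le: "l \<le> exp (C - \<delta> * \<beta>)"
    proof (cases "l = 0")
      case False
      then have lpos: "l > 0"
        using l by simp
      have "l * (\<beta> * \<Delta>) \<le> l * (n\<^sup>2 + n - n * ln l)"
        using gap HS Lmax[OF Y] by (simp add: entropy_term_def algebra_simps)
      then have "n * ln l \<le> n\<^sup>2 + n - \<beta> * \<Delta>"
        using lpos by simp
      then have "ln l \<le> (n\<^sup>2 + n - \<beta> * \<Delta>) / n"
        using n by (simp add: pos_le_divide_eq mult.commute)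
      then have "ln l \<le> C - \<delta> * \<beta>"
        by (simp add: C_def \<delta>_def diff_divide_distrib mult.commute)
      then show ?thesis
        using lpos by (metis exp_le_cancel_iff exp_ln)
    qed simp
    \<comment> \<open>The square root in the strong concavity bound, applied to O(sqrt l), leads to the fourth root of l.\<close>
    define q where "q = sqrt (sqrt l)"
    have q: "0 \<le> q" "q \<le> 1" "q\<^sup>2 = sqrt l" "q ^ 4 = l"
      using l by (auto simp: q_def power4_eq_xxxx power2_eq_square[symmetric] mult.assoc)
    have lq: "l \<le> q\<^sup>2" "l \<le> q"
      using q power_decreasing[of 2 4 q] power_decreasing[of 1 4 q] by auto
    have "(norm (Y - L))\<^sup>2 \<le> 4 * (matrix_entropy L - matrix_entropy Y)"
      using is_arg_max_norm_diff_le[OF F(1,3) _ L Y] by simp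
    also have "\<dots> \<le> 4 * (l * (n\<^sup>2 + n) + n * entropy_term l)"
    proof -
      \<comment> \<open>With \<open>gap\<close> this shows that S has at least the entropy of L, so
        \<open>HS\<close> bounds the entropy deficit of Y.\<close>
      have "0 \<le> \<beta> * (l * \<Delta>)"
        using \<beta> l \<open>\<Delta> > 0\<close> by simp
      then show ?thesis
        using gap HS by simp
    qed
    also have "\<dots> \<le> 4 * (q\<^sup>2 * (n\<^sup>2 + n) + n * (2 * q\<^sup>2))"
      using lq n q l entropy_term_le_sqrt[of l]
      by (intro mult_left_mono add_mono mult_right_mono) auto
    also have "\<dots> = A * q\<^sup>2"
      by (simp add: A_def algebra_simps)
    finally have "norm (Y - L) \<le> sqrt (A * q\<^sup>2)"
      by (rule real_le_rsqrt)
    then have YL: "norm (Y - L) \<le> sqrt A * q"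
      using q(1) by (simp add: real_sqrt_mult)
    have "S - Y = l *\<^sub>R (Z - Y)"
      by (simp add: Seq algebra_simps)
    then have "norm (S - Y) = l * norm (Z - Y)"
      using l by simp
    also have "\<dots> \<le> q * (2 * D)"
      using lq q l D[OF Z] D[OF Y'] norm_triangle_ineq4[of Z Y] by (intro mult_mono) auto
    finally have "norm (S - L) \<le> (2 * D + sqrt A) * q"
      using YL norm_triangle_ineq[of "S - Y" "Y - L"] by (simp add: algebra_simps)
    also have "\<dots> \<le> (2 * D + sqrt A) * exp ((C - \<delta> * \<beta>) / 4)"
    proof (rule mult_left_mono)
      have "q ^ 4 \<le> exp ((C - \<delta> * \<beta>) / 4) ^ 4"
        using l_le q by (simp add: diff_divide_distrib flip: exp_of_nat_mult)
      \<comment> \<open>The rule speaks of \<open>Suc n\<close> as exponent, hence 3 for the fourth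
        power.\<close>
      then show "q \<le> exp ((C - \<delta> * \<beta>) / 4)"
        by (rule power_le_imp_le_base[of _ 3, simplified]) simp
      show "0 \<le> 2 * D + sqrt A"
        using order.trans[OF norm_ge_zero D[OF S]] \<open>A \<ge> 0\<close> by simp
    qed
    also have "\<dots> = (2 * D + sqrt A) * exp (C / 4) * exp (- (\<delta> / 4) * \<beta>)"
      by (simp add: diff_divide_distrib flip: exp_add)
    finally show ?thesis
      by (simp add: S_def)
  qed
  show ?thesis
    using that[of "\<delta> / 4" L, OF _ bound] \<open>\<Delta> > 0\<close> n by (simp add: \<delta>_def)
qed

theorem proposition1:
  fixes X :: "real ^ 'n ^ 'n"
  shows "\<exists>c \<mu> :: real. \<mu> > 0 \<and>
    (\<forall>\<beta> > 0.
       \<bar>softassign \<beta> X \<bullet> X - softassign_limit X \<bullet> X\<bar>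
         \<le> norm (softassign \<beta> X - softassign_limit X) * norm X \<and>
       norm (softassign \<beta> X - softassign_limit X) \<le> c / \<mu> * exp (- \<mu> * \<beta>))"
proof -
  obtain L c \<mu> where \<mu>: "\<mu> > 0"
    and bound: "\<And>\<beta>. \<beta> > 0 \<Longrightarrow> norm (softassign \<beta> X - L) \<le> c * exp (- \<mu> * \<beta>)"
    using softassign_exponential_bound[of X] by blast
  have "filterlim (\<lambda>\<beta>. - \<mu> * \<beta>) at_bot at_top"
    using \<mu> by (intro filterlim_tendsto_neg_mult_at_bot[OF tendsto_const _ filterlim_ident]) simp
  then have "((\<lambda>\<beta>. c * exp (- \<mu> * \<beta>)) \<longlongrightarrow> c * 0) at_top"
    by (intro tendsto_mult_left filterlim_compose[OF exp_at_bot])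
  then have null: "((\<lambda>\<beta>. c * exp (- \<mu> * \<beta>)) \<longlongrightarrow> 0) at_top"
    by simp
  have "\<forall>\<^sub>F \<beta> in at_top. norm (softassign \<beta> X - L) \<le> c * exp (- \<mu> * \<beta>)"
    using eventually_gt_at_top[of 0] by (rule eventually_mono) (rule bound)
  then have "((\<lambda>\<beta>. softassign \<beta> X) \<longlongrightarrow> L) at_top"
    using null by (rule LIM_zero_cancel[OF Lim_null_comparison])
  \<comment> \<open>The limit at a nontrivial filter is unique, so \<open>Lim\<close> returns
    L.\<close>
  then have lim: "softassign_limit X = L"
    unfolding softassign_limit_def by (rule tendsto_Lim[OF trivial_limit_at_top_linorder])
  have "\<bar>S \<bullet> X - L \<bullet> X\<bar> \<le> norm (S - L) * norm X" for S
    unfolding inner_diff_left[symmetric] by (rule Cauchy_Schwarz_ineq2)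
  \<comment> \<open>The constant is scaled by \<mu> to match the required form with division by
    \<mu>.\<close>
  moreover have "norm (softassign \<beta> X - L) \<le> c * \<mu> / \<mu> * exp (- \<mu> * \<beta>)" if "\<beta> > 0" for \<beta>
    using bound[OF that] \<mu> by simp
  ultimately show ?thesis
    unfolding lim using \<mu> by blast
qed

end
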